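(* Let $0<q<1$, let $A_i,\alpha_i>0$, $a_i\ge 0$ for $i=1,\dots,p$ and $B_j,\beta_j>0$, $b_j\ge0$ for $j=1,\dots,s$, and for $x>0$ let $$W_q(x)=\frac{\prod_{i=1}^p\Gamma_q(A_ix+a_i)^{\alpha_i}}{\prod_{j=1}^s\Gamma_q(B_jx+b_j)^{\beta_j}}.$$ Then $W_q$ is logarithmically completely monotonic if and only if the following three conditions hold: (1) there exist $n_1,\dots,n_s\in\mathbb N$ and indices $i_1,\dots,i_s\in\{1,\dots,p\}$ (not necessarily distinct) such that $B_j=n_jA_{i_j}$ for $j=1,\dots,s$ (equivalently, $\hat{\mathcal B}\subset\hat{\mathcal A}$); (2) for each $t\in\hat{\mathcal B}$, $$\sum_{\substack{(n,i):\, nA_i\log(1/q)=t}}\frac{n}{1-q^n}\,\alpha_iA_i^2q^{na_i}\;\ge\;\sum_{\substack{(m,j):\, mB_j\log(1/q)=t}}\frac{m}{1-q^m}\,\beta_jB_j^2q^{mb_j},$$ where the sums run over $n\in\mathbb N$, $1\le i\le p$ and $m\in\mathbb N$, $1\le j\le s$, respectively; (3) $\displaystyle\sum_{i=1}^{p}\alpha_{i}A_{i}\le\sum_{j=1}^{s}\beta_{j}B_{j}$.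
   Context: $\mathbb N=\{1,2,3,\dots\}$. For $0<q<1$ and $x>0$ the $q$-gamma function is $\Gamma_q(x)=(1-q)^{1-x}\prod_{n=0}^\infty\frac{1-q^{n+1}}{1-q^{x+n}}$. $\hat{\mathcal A}=\{nA_i\log(1/q): n\in\mathbb N,\ i=1,\dots,p\}$ and $\hat{\mathcal B}=\{mB_j\log(1/q): m\in\mathbb N,\ j=1,\dots,s\}$. A function $f:(0,\infty)\to\mathbb R$ is completely monotonic if it is infinitely differentiable, $f\ge0$, and $(-1)^nf^{(n)}(x)\ge0$ for all $n\ge1$, $x>0$. A positive function $f$ on $(0,\infty)$ is logarithmically completely monotonic if $-(\log f)'$ is completely monotonic. *)

theory Defs
  imports "HOL-Analysis.Analysis"
begin

definition q_Gamma :: "real \<Rightarrow> real \<Rightarrow> real" where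
  "q_Gamma q x = (1 - q) powr (1 - x) *
     prodinf (\<lambda>n. (1 - q ^ (n + 1)) / (1 - q powr (x + real n)))"

text \<open>Functions on $(0,\infty)$ are represented by total functions on the reals. As $(0,\infty)$
  is open, iterated \<^const>\<open>deriv\<close> at a positive point does not depend on the
  values at nonpositive points.\<close>

definition completely_monotonic :: "(real \<Rightarrow> real) \<Rightarrow> bool" where
  "completely_monotonic f \<longleftrightarrow>
     (\<forall>n. \<forall>x>0. (deriv ^^ n) f differentiable (at x)) \<and>
     (\<forall>x>0. 0 \<le> f x) \<and>
     (\<forall>n\<ge>1. \<forall>x>0. 0 \<le> (- 1) ^ n * (deriv ^^ n) f x)"

text \<open>Differentiability of $\log f$ is stated explicitly, since \<^const>\<open>deriv\<close> also
  has an unspecified value where the derivative does not exist.\<close>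

definition log_completely_monotonic :: "(real \<Rightarrow> real) \<Rightarrow> bool" where
  "log_completely_monotonic f \<longleftrightarrow>
     (\<forall>x>0. 0 < f x) \<and>
     (\<forall>x>0. (\<lambda>y. ln (f y)) differentiable (at x)) \<and>
     completely_monotonic (\<lambda>x. - deriv (\<lambda>y. ln (f y)) x)"

definition W_q ::
  "real \<Rightarrow> nat \<Rightarrow> (nat \<Rightarrow> real) \<Rightarrow> (nat \<Rightarrow> real) \<Rightarrow> (nat \<Rightarrow> real) \<Rightarrow>
   nat \<Rightarrow> (nat \<Rightarrow> real) \<Rightarrow> (nat \<Rightarrow> real) \<Rightarrow> (nat \<Rightarrow> real) \<Rightarrow> real \<Rightarrow> real" where
  "W_q q p A a \<alpha> s B b \<beta> x =
     (\<Prod>i=1..p. q_Gamma q (A i * x + a i) powr \<alpha> i) /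
     (\<Prod>j=1..s. q_Gamma q (B j * x + b j) powr \<beta> j)"

text \<open>\<open>hat_set q p A\<close> is $\hat{\mathcal A}$ and \<open>hat_set q s B\<close> is $\hat{\mathcal B}$.\<close>

definition hat_set :: "real \<Rightarrow> nat \<Rightarrow> (nat \<Rightarrow> real) \<Rightarrow> real set" where
  "hat_set q p A = {real n * A i * ln (1 / q) | n i. 1 \<le> n \<and> i \<in> {1..p}}"

end

theory Submission
  imports Defs
begin

text \<open>Put $L = \log(1/q)$. The logarithm of $\Gamma_q(y)$ is an affine function of $y$ plus
  the quantum dilogarithm $\sum_{k\ge1} z^k/(k(1-q^k))$ at $z = q^y$. Differentiation therefore turns
  $F = -(\log W_q)'$ into a constant plus a difference of two Dirichlet series with positive
  coefficients,
  \[ F(x) = \log(1-q)\Big(\sum_i \alpha_iA_i-\sum_j\beta_jB_j\Big)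
     + L\Big(\sum_{n,i} \frac{\alpha_iA_iq^{na_i}}{1-q^n}\,e^{-nA_iLx}
     - \sum_{m,j} \frac{\beta_jB_jq^{mb_j}}{1-q^m}\,e^{-mB_jLx}\Big), \]
  whose exponents run through $\hat{\mathcal A}$ and $\hat{\mathcal B}$. Here $\log(1-q)<0$, so
  the constant is nonnegative exactly if $\sum_i\alpha_iA_i\le\sum_j\beta_jB_j$. Multiplied by $t/L$,
  the coefficient of $e^{-tx}$ in either series becomes the finite sum attached to
  $t\in\hat{\mathcal B}$ in the theorem, so the comparison of these sums says that the total
  coefficient of $e^{-tx}$ is nonnegative. This forces every such $t$ to lie in $\hat{\mathcal A}$,
  that is, each $B_j$ to be a multiple of some $A_i$. The claim thus reads: $F$ is completely monotonic if
  and only if its constant term and all its coefficients are nonnegative.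

  If they are, then comparing the two series exponent by exponent gives the sign of every derivative
  (\<open>infsum_le_infsum_fibrewise\<close>). Conversely, $F\ge0$ and $F(x)$ tends to the constant term
  as $x\to\infty$. A single coefficient is isolated as follows
  (\<open>tendsto_infsum_exp_peak\<close>): in $(-1)^nF^{(n)}(x)$ the exponent $t$ carries the weight
  $t^ne^{-tx}$, and at $x = n/t_0$ this is the $n$-th power of $te^{-t/t_0}$, which has
  its only maximum $t_0/e$ at $t = t_0$. Dividing by $(t_0/e)^n$ and letting $n\to\infty$, dominated
  convergence removes all terms but those with $t=t_0$.\<close>

section \<open>The quantum dilogarithm and its logarithmic derivatives\<close>

text \<open>For $m=0$ this is the quantum dilogarithm $-\log\prod_{n\ge0}(1-zq^n)$. Raising $m$ by one applies
  $z\,\frac{d}{dz}$, so that all derivatives of $x\mapsto\log\Gamma_q(Ax+a)$ are covered. The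
  coefficient $k^{m-1}/(1-q^k)$ is written without cancelling $k$, so that $m=0$ needs no negative
  exponent. The term $k=0$ vanishes for every $m$ since $c/0=0$.\<close>
definition quantum_polylog :: "real \<Rightarrow> nat \<Rightarrow> real \<Rightarrow> real" where
  "quantum_polylog q m z = (\<Sum>k. real k ^ m / (real k * (1 - q ^ k)) * z ^ k)"

text \<open>The operator $z\,\frac{d}{dz}$ multiplies the $k$-th coefficient of a power series by $k$; unlike
  plain differentiation it leaves the exponents in place.\<close>
lemma sums_theta_powser:
  fixes z :: real
  assumes "\<And>x :: real. \<bar>x\<bar> < 1 \<Longrightarrow> summable (\<lambda>k. c k * x ^ k)" and "\<bar>z\<bar> < 1"
  shows "(\<lambda>k. real k * c k * z ^ k) sums (z * (\<Sum>k. diffs c k * z ^ k))"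
proof -
  have "(\<lambda>k. real k * c k * z ^ (k - Suc 0)) sums (\<Sum>k. diffs c k * z ^ k)"
    using assms by (intro diffs_equiv termdiff_converges[of _ 1]) auto
  then have "(\<lambda>k. z * (real k * c k * z ^ (k - Suc 0))) sums (z * (\<Sum>k. diffs c k * z ^ k))"
    by (rule sums_mult)
  moreover have "z * (real k * c k * z ^ (k - Suc 0)) = real k * c k * z ^ k" for k
    by (cases k) auto
  ultimately show ?thesis
    by (simp only:)
qed

lemma summable_quantum_polylog:
  assumes q: "0 < q" "q < 1" and "\<bar>z\<bar> < 1"
  shows "summable (\<lambda>k. real k ^ m / (real k * (1 - q ^ k)) * z ^ k)"
  using \<open>\<bar>z\<bar> < 1\<close>
proof (induction m arbitrary: z)
  case 0
  have bound: "\<bar>1 / (real k * (1 - q ^ k))\<bar> \<le> 1 / (1 - q)" for k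
  proof (cases "k = 0")
    case False
    then have "q ^ k \<le> q ^ 1"
      using q by (intro power_decreasing) auto
    then have "1 * (1 - q) \<le> real k * (1 - q ^ k)"
      using False q by (intro mult_mono) auto
    then show ?thesis
      using q by (simp add: frac_le)
  qed (use q in auto)
  show ?case
  proof (rule summable_comparison_test')
    show "summable (\<lambda>k. 1 / (1 - q) * \<bar>z\<bar> ^ k)"
      using 0 by (intro summable_mult summable_geometric) auto
    show "norm (real k ^ 0 / (real k * (1 - q ^ k)) * z ^ k) \<le> 1 / (1 - q) * \<bar>z\<bar> ^ k" for k
      using mult_right_mono[OF bound[of k], of "\<bar>z\<bar> ^ k"] by (simp add: abs_mult power_abs)
  qed
next
  case (Suc m)
  let ?c = "\<lambda>k. real k ^ m / (real k * (1 - q ^ k))"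
  have "(\<lambda>k. real k * ?c k * z ^ k) sums (z * (\<Sum>k. diffs ?c k * z ^ k))"
    using Suc by (intro sums_theta_powser) auto
  then show ?case
    by (simp only: sums_iff power_Suc times_divide_eq_right)
qed

lemma DERIV_quantum_polylog:
  assumes q: "0 < q" "q < 1" and z: "0 < z" "z < 1"
  shows "(quantum_polylog q m has_real_derivative quantum_polylog q (Suc m) z / z) (at z)"
proof -
  let ?c = "\<lambda>k. real k ^ m / (real k * (1 - q ^ k))"
  have summable: "summable (\<lambda>k. ?c k * x ^ k)" if "norm x < 1" for x
    using summable_quantum_polylog[OF q, of x m] that by simp
  have "(\<lambda>k. real k * ?c k * z ^ k) sums (z * (\<Sum>k. diffs ?c k * z ^ k))"
    using z summable by (intro sums_theta_powser) auto
  then have "quantum_polylog q (Suc m) z = z * (\<Sum>k. diffs ?c k * z ^ k)"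
    by (simp only: sums_iff quantum_polylog_def power_Suc times_divide_eq_right)
  moreover have "((\<lambda>x. \<Sum>k. ?c k * x ^ k) has_real_derivative (\<Sum>k. diffs ?c k * z ^ k)) (at z)"
    using z by (intro termdiffs_strong'[of 1] summable) auto
  ultimately show ?thesis
    using z by (simp add: quantum_polylog_def[abs_def])
qed

lemma tendsto_quantum_polylog_0:
  assumes q: "0 < q" "q < 1" and f: "(f \<longlongrightarrow> 0) F"
  shows "((\<lambda>x. quantum_polylog q m (f x)) \<longlongrightarrow> 0) F"
proof -
  let ?c = "\<lambda>k. real k ^ m / (real k * (1 - q ^ k))"
  have "isCont (\<lambda>x. \<Sum>k. ?c k * x ^ k) 0"
  proof (rule DERIV_isCont)
    show "((\<lambda>x. \<Sum>k. ?c k * x ^ k) has_real_derivative (\<Sum>k. diffs ?c k * 0 ^ k)) (at 0)"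
      using summable_quantum_polylog[OF q, of _ m] by (intro termdiffs_strong'[of 1]) auto
  qed
  then have "isCont (quantum_polylog q m) 0"
    by (simp add: quantum_polylog_def[abs_def])
  moreover have "quantum_polylog q m 0 = 0"
    unfolding quantum_polylog_def powser_zero by simp
  ultimately show ?thesis
    using isCont_tendsto_compose[OF _ f] by fastforce
qed

text \<open>The factor $1-q^k$ in the denominators cancels against $z^k-(qz)^k$, leaving the logarithm series.
  Telescoping this equation along $z, qz, q^2z,\dots$ evaluates the infinite product in $\Gamma_q$
  without an interchange of summations.\<close>
lemma quantum_dilog_q_difference:
  assumes q: "0 < q" "q < 1" and z: "0 < z" "z < 1"
  shows "quantum_polylog q 0 z - quantum_polylog q 0 (q * z) = - ln (1 - z)"
proof -
  have qz: "0 < q * z" "q * z < 1"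
    using q z mult_strict_mono[of q 1 z 1] by auto
  have coeff: "1 / (real k * (1 - q ^ k)) * z ^ k - 1 / (real k * (1 - q ^ k)) * (q * z) ^ k
      = z ^ k / real k" for k
  proof (cases "k = 0")
    case False
    then have "1 - q ^ k \<noteq> 0"
      using q power_strict_decreasing[of 0 k q] by auto
    moreover have "1 / (real k * (1 - q ^ k)) * z ^ k - 1 / (real k * (1 - q ^ k)) * (q * z) ^ k
        = z ^ k * (1 - q ^ k) / (real k * (1 - q ^ k))"
      by (simp add: power_mult_distrib algebra_simps flip: diff_divide_distrib)
    ultimately show ?thesis
      using False by simp
  qed auto
  have "(\<lambda>k. real k ^ 0 / (real k * (1 - q ^ k)) * z ^ k
      - real k ^ 0 / (real k * (1 - q ^ k)) * (q * z) ^ k) sums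
      (quantum_polylog q 0 z - quantum_polylog q 0 (q * z))"
    unfolding quantum_polylog_def using qz z
    by (intro sums_diff summable_sums summable_quantum_polylog q) auto
  then have "(\<lambda>k. z ^ k / real k) sums (quantum_polylog q 0 z - quantum_polylog q 0 (q * z))"
    using coeff by simp
  moreover have "(\<lambda>k. z ^ k / real k) sums (- ln (1 - z))"
    using sums_minus[OF ln_series'[of "-z"]] z by simp
  ultimately show ?thesis
    using sums_unique2 by blast
qed

lemma prod_one_minus_eq_quantum_dilog:
  assumes q: "0 < q" "q < 1" and z: "0 < z" "z < 1"
  shows "(\<Prod>i<n. 1 - z * q ^ i) = exp (quantum_polylog q 0 (z * q ^ n) - quantum_polylog q 0 z)"
proof (induction n)
  case (Suc n)
  have "z * q ^ n \<le> z * 1"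
    using q z by (intro mult_left_mono power_le_one) auto
  also have "z * 1 < 1"
    using z by simp
  finally have zn: "0 < z * q ^ n" "z * q ^ n < 1"
    using q z by auto
  have "quantum_polylog q 0 (z * q ^ Suc n) - quantum_polylog q 0 (z * q ^ n) = ln (1 - z * q ^ n)"
    using quantum_dilog_q_difference[OF q zn] by (simp add: mult_ac)
  then have "1 - z * q ^ n =
      exp (quantum_polylog q 0 (z * q ^ Suc n) - quantum_polylog q 0 (z * q ^ n))"
    using zn by simp
  then show ?case
    using Suc by (simp flip: exp_add)
qed auto

lemma q_Gamma_eq_quantum_dilog:
  assumes q: "0 < q" "q < 1" and x: "0 < x"
  shows "q_Gamma q x =
    exp ((1 - x) * ln (1 - q) + quantum_polylog q 0 (q powr x) - quantum_polylog q 0 q)"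
proof -
  let ?Q = "quantum_polylog q 0"
  define z where "z = q powr x"
  have z: "0 < z" "z < 1"
    using q x powr_less_mono2[of x q 1] by (auto simp: z_def)
  let ?f = "\<lambda>n. (1 - q ^ (n + 1)) / (1 - q powr (x + real n))"
  have partial: "(\<Prod>i\<le>n. ?f i) = exp (?Q (q * q ^ Suc n) - ?Q q - (?Q (z * q ^ Suc n) - ?Q z))" for n
  proof -
    have "(\<Prod>i\<le>n. ?f i) = (\<Prod>i<Suc n. 1 - q * q ^ i) / (\<Prod>i<Suc n. 1 - z * q ^ i)"
      using q by (simp add: prod_dividef lessThan_Suc_atMost powr_add powr_realpow z_def)
    then show ?thesis
      using q z by (simp only: prod_one_minus_eq_quantum_dilog exp_diff)
  qed
  have "(\<lambda>n. q ^ Suc n) \<longlonglongrightarrow> 0"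
    using LIMSEQ_Suc[OF LIMSEQ_power_zero[of q]] q by simp
  then have "(\<lambda>n. ?Q (c * q ^ Suc n)) \<longlonglongrightarrow> 0" for c
    by (intro tendsto_quantum_polylog_0 q) (auto intro: tendsto_mult_right_zero)
  then have "(\<lambda>n. exp (?Q (q * q ^ Suc n) - ?Q q - (?Q (z * q ^ Suc n) - ?Q z)))
      \<longlonglongrightarrow> exp (0 - ?Q q - (0 - ?Q z))"
    by (intro tendsto_intros)
  then have "raw_has_prod ?f 0 (exp (?Q z - ?Q q))"
    unfolding raw_has_prod_def add_0_right partial by simp
  then have "?f has_prod exp (?Q z - ?Q q)"
    unfolding has_prod_def by blast
  then have "prodinf ?f = exp (?Q z - ?Q q)"
    by (rule has_prod_unique[symmetric])
  then show ?thesis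
    using q by (simp add: q_Gamma_def powr_def z_def flip: exp_add)
qed

section \<open>Comparing sums of exponentials\<close>

text \<open>The bound starts at $n=1$ since the peak weights used below satisfy $u^n\le u$ only from there on.\<close>
lemma tendsto_infsum_dominated:
  fixes f :: "'i \<Rightarrow> nat \<Rightarrow> real"
  assumes lim: "\<And>z. z \<in> P \<Longrightarrow> (\<lambda>n. f z n) \<longlonglongrightarrow> l z"
    and bound: "\<And>z n. z \<in> P \<Longrightarrow> 1 \<le> n \<Longrightarrow> \<bar>f z n\<bar> \<le> M z"
    and M: "M summable_on P"
  shows "(\<lambda>n. \<Sum>\<^sub>\<infinity>z\<in>P. f z n) \<longlonglongrightarrow> (\<Sum>\<^sub>\<infinity>z\<in>P. l z)"
proof -
  have l_bound: "\<bar>l z\<bar> \<le> M z" if "z \<in> P" for z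
  proof (rule LIMSEQ_le_const2[OF tendsto_rabs[OF lim[OF that]]])
    show "\<exists>N. \<forall>n\<ge>N. \<bar>f z n\<bar> \<le> M z"
      using bound[OF that] by blast
  qed
  have unif: "uniform_limit {1..} (\<lambda>X n. \<Sum>z\<in>X. f z n) (\<lambda>n. \<Sum>\<^sub>\<infinity>z\<in>P. f z n)
      (finite_subsets_at_top P)"
    by (rule Weierstrass_m_test_general[OF _ M]) (use bound in auto)
  have "l summable_on P"
    by (rule Infinite_Sum.abs_summable_summable, rule Infinite_Sum.abs_summable_on_comparison_test'[OF M])
      (use l_bound in auto)
  then have "(sum l \<longlongrightarrow> infsum l P) (finite_subsets_at_top P)"
    using has_sum_infsum by (auto simp: has_sum_def)
  moreover have "\<forall>\<^sub>F X in finite_subsets_at_top P. (\<lambda>n. \<Sum>z\<in>X. f z n) \<longlonglongrightarrow> sum l X"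
    using lim by (intro eventually_finite_subsets_at_top_weakI tendsto_sum) auto
  moreover have "\<forall>\<^sub>F n :: nat in sequentially. n \<in> {1..}"
    using eventually_ge_at_top[of 1] by simp
  ultimately show ?thesis
    using swap_uniform_limit'[OF _ _ unif] by force
qed

lemma mult_exp_less_one:
  fixes u :: real
  assumes "u \<noteq> 1"
  shows "u * exp (1 - u) < 1"
proof -
  have "u < exp (u - 1)"
    using exp_minus_greater[of "1 - u"] assms by simp
  then show ?thesis
    by (simp add: exp_diff field_simps)
qed

text \<open>With $u = (\nu/t)\,e^{1-\nu/t}$ the scaled term is $w\,u^n$, and $u\le1$ with equality only
  for $\nu=t$: the powers $u^n$ select the terms of exponent $t$, and the summable $w\,u$ dominates
  them.\<close>
lemma tendsto_infsum_exp_peak: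
  fixes w \<nu> :: "'i \<Rightarrow> real"
  assumes pos: "\<And>z. z \<in> P \<Longrightarrow> 0 < \<nu> z" "\<And>z. z \<in> P \<Longrightarrow> 0 \<le> w z" and t: "0 < t"
    and summable: "(\<lambda>z. w z * \<nu> z ^ 1 * exp (- \<nu> z * (real 1 / t))) summable_on P"
  shows "(\<lambda>n. (exp 1 / t) ^ n * (\<Sum>\<^sub>\<infinity>z\<in>P. w z * \<nu> z ^ n * exp (- \<nu> z * (real n / t))))
    \<longlonglongrightarrow> (\<Sum>\<^sub>\<infinity>z\<in>{z \<in> P. \<nu> z = t}. w z)"
proof -
  define u where "u z = \<nu> z / t * exp (1 - \<nu> z / t)" for z
  have scaled: "(exp 1 / t) ^ n * (w z * \<nu> z ^ n * exp (- \<nu> z * (real n / t))) = w z * u z ^ n" for z n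
  proof -
    have e: "exp (- \<nu> z * (real n / t)) = exp (- \<nu> z / t) ^ n"
      by (simp flip: exp_of_nat_mult)
    have u: "u z = exp 1 / t * \<nu> z * exp (- \<nu> z / t)"
      by (simp add: u_def exp_diff exp_minus field_simps)
    show ?thesis
      by (simp only: e u power_mult_distrib mult_ac)
  qed
  have u: "0 \<le> u z" "u z \<le> 1" if "z \<in> P" for z
    using pos(1)[OF that] t mult_exp_less_one[of "\<nu> z / t"] by (cases "\<nu> z = t"; auto simp: u_def)+
  have "(\<lambda>n. \<Sum>\<^sub>\<infinity>z\<in>P. w z * u z ^ n) \<longlonglongrightarrow> (\<Sum>\<^sub>\<infinity>z\<in>P. if \<nu> z = t then w z else 0)"
  proof (rule tendsto_infsum_dominated)
    show "(\<lambda>z. w z * u z ^ 1) summable_on P"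
      using summable_on_cmult_right[OF summable, of "(exp 1 / t) ^ 1"] unfolding scaled .
    show "\<bar>w z * u z ^ n\<bar> \<le> w z * u z ^ 1" if "z \<in> P" "1 \<le> n" for z n
      using power_decreasing[OF that(2) u[OF that(1)]] pos(2)[OF that(1)] u[OF that(1)]
      by (simp add: abs_mult mult_left_mono)
    show "(\<lambda>n. w z * u z ^ n) \<longlonglongrightarrow> (if \<nu> z = t then w z else 0)" if "z \<in> P" for z
    proof (cases "\<nu> z = t")
      case True
      then show ?thesis
        using t by (simp add: u_def)
    next
      case False
      then have "u z < 1"
        using mult_exp_less_one[of "\<nu> z / t"] t by (simp add: u_def)
      then show ?thesis
        using u[OF that] False by (auto intro!: tendsto_mult_right_zero LIMSEQ_power_zero)
    qed
  qed
  moreover have "(\<Sum>\<^sub>\<infinity>z\<in>P. if \<nu> z = t then w z else 0) = (\<Sum>\<^sub>\<infinity>z\<in>{z \<in> P. \<nu> z = t}. w z)"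
    by (intro infsum_cong_neutral) auto
  ultimately show ?thesis
    by (simp only: scaled flip: infsum_cmult_right')
qed

text \<open>A finite part of the left sum meets finitely many values of the exponent. Completing it to full
  fibres only increases it, and the corresponding fibres of the right sum form a finite part of that
  sum.\<close>
lemma infsum_le_infsum_fibrewise:
  fixes w v :: "_ \<Rightarrow> real"
  assumes w: "w summable_on P" "\<And>z. z \<in> P \<Longrightarrow> 0 \<le> w z"
    and v: "v summable_on Q" "\<And>z. z \<in> Q \<Longrightarrow> 0 \<le> v z"
    and finite: "\<And>t. finite {z \<in> P. \<nu> z = t}" "\<And>t. finite {z \<in> Q. \<mu> z = t}"
    and le: "\<And>t. t \<in> \<mu> ` Q \<Longrightarrow> (\<Sum>z\<in>{z \<in> Q. \<mu> z = t}. v z) \<le> (\<Sum>z\<in>{z \<in> P. \<nu> z = t}. w z)"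
  shows "infsum v Q \<le> infsum w P"
proof (rule infsum_le_finite_sums[OF v(1)])
  fix X assume X: "finite X" "X \<subseteq> Q"
  have "sum v X \<le> sum v (\<Union>t\<in>\<mu> ` X. {z \<in> Q. \<mu> z = t})"
    using X finite v(2) by (intro sum_mono2) auto
  also have "\<dots> = (\<Sum>t\<in>\<mu> ` X. \<Sum>z\<in>{z \<in> Q. \<mu> z = t}. v z)"
    using X finite by (intro sum.UNION_disjoint) auto
  also have "\<dots> \<le> (\<Sum>t\<in>\<mu> ` X. \<Sum>z\<in>{z \<in> P. \<nu> z = t}. w z)"
    using X by (intro sum_mono le) auto
  also have "\<dots> = sum w (\<Union>t\<in>\<mu> ` X. {z \<in> P. \<nu> z = t})"
    using X finite by (intro sum.UNION_disjoint[symmetric]) auto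
  also have "\<dots> \<le> infsum w P"
    using X finite w by (intro finite_sum_le_infsum) auto
  finally show "sum v X \<le> infsum w P" .
qed

section \<open>The Dirichlet series of a quotient of $q$-gamma functions\<close>

text \<open>The pair $(n,i)$ stands for the term of the Dirichlet series that comes from the $k=n$ term of the
  $i$-th quantum polylogarithm; coinciding exponents are not merged.\<close>
definition freq :: "real \<Rightarrow> (nat \<Rightarrow> real) \<Rightarrow> nat \<times> nat \<Rightarrow> real" where
  "freq q A = (\<lambda>(n, i). real n * A i * ln (1 / q))"

definition dirichlet_coeff ::
  "real \<Rightarrow> (nat \<Rightarrow> real) \<Rightarrow> (nat \<Rightarrow> real) \<Rightarrow> (nat \<Rightarrow> real) \<Rightarrow> nat \<times> nat \<Rightarrow> real" where
  "dirichlet_coeff q A a \<alpha> = (\<lambda>(n, i). \<alpha> i * A i * q powr (real n * a i) / (1 - q ^ n))"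

text \<open>Since $\Gamma_q'/\Gamma_q$ at $y$ is $-\log(1-q)-\log(1/q)\sum_k q^{ky}/(1-q^k)$, the case $m=0$ is the
  varying part of $(\log\prod_i\Gamma_q(A_ix+a_i)^{\alpha_i})'$ divided by $-\log(1/q)$, and the general case
  is $(-1)^m$ times its $m$-th derivative. This closed form is convenient for differentiation;
  the lemma \<open>has_sum_psi_sum\<close> gives the form as a Dirichlet series.\<close>
definition psi_sum ::
  "real \<Rightarrow> nat \<Rightarrow> (nat \<Rightarrow> real) \<Rightarrow> (nat \<Rightarrow> real) \<Rightarrow> (nat \<Rightarrow> real) \<Rightarrow> nat \<Rightarrow> real \<Rightarrow> real" where
  "psi_sum q p A a \<alpha> m x =
    (\<Sum>i=1..p. \<alpha> i * A i * (A i * ln (1 / q)) ^ m * quantum_polylog q (Suc m) (q powr (A i * x + a i)))"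

lemma freq_pos:
  assumes "0 < q" "q < 1" "\<And>i. i \<in> {1..p} \<Longrightarrow> 0 < A i" and "z \<in> {1..} \<times> {1..p}"
  shows "0 < freq q A z"
  using assms by (auto simp: freq_def)

lemma dirichlet_coeff_pos:
  assumes "0 < q" "q < 1" "\<And>i. i \<in> {1..p} \<Longrightarrow> 0 < A i \<and> 0 < \<alpha> i" and "z \<in> {1..} \<times> {1..p}"
  shows "0 < dirichlet_coeff q A a \<alpha> z"
  using assms by (auto simp: dirichlet_coeff_def power_strict_mono power_less_one_iff)

text \<open>For a given $i$ at most one $n$ satisfies $nA_i\log(1/q)=t$.\<close>
lemma finite_freq_fibre:
  assumes q: "0 < q" "q < 1" and A: "\<And>i. i \<in> {1..p} \<Longrightarrow> 0 < A i"
  shows "finite {z \<in> {1..} \<times> {1..p}. freq q A z = t}"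
proof (rule inj_on_finite)
  show "inj_on snd {z \<in> {1..} \<times> {1..p}. freq q A z = t}"
    using q A by (force simp: inj_on_def freq_def)
  show "snd ` {z \<in> {1..} \<times> {1..p}. freq q A z = t} \<subseteq> {1..p}"
    by auto
qed simp

lemma hat_set_eq_freq_image: "hat_set q p A = freq q A ` ({1..} \<times> {1..p})"
  by (force simp: hat_set_def freq_def image_iff)

lemma has_sum_psi_sum:
  assumes q: "0 < q" "q < 1" and x: "0 < x"
    and A: "\<And>i. i \<in> {1..p} \<Longrightarrow> 0 < A i \<and> 0 < \<alpha> i \<and> 0 \<le> a i"
  shows "((\<lambda>z. dirichlet_coeff q A a \<alpha> z * freq q A z ^ m * exp (- freq q A z * x)) has_sum
    psi_sum q p A a \<alpha> m x) ({1..} \<times> {1..p})"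
proof -
  let ?h = "\<lambda>z. dirichlet_coeff q A a \<alpha> z * freq q A z ^ m * exp (- freq q A z * x)"
  let ?s = "\<lambda>i. \<alpha> i * A i * (A i * ln (1 / q)) ^ m * quantum_polylog q (Suc m) (q powr (A i * x + a i))"
  have inner: "((\<lambda>n. ?h (n, i)) has_sum ?s i) {1..}" if i: "i \<in> {1..p}" for i
  proof -
    define z where "z = q powr (A i * x + a i)"
    have "0 < A i * x + a i"
      using A[OF i] x by (simp add: add_pos_nonneg)
    then have z: "0 < z" "z < 1"
      using q powr_less_mono2[of "A i * x + a i" q 1] by (auto simp: z_def)
    define c where "c = \<alpha> i * A i * (A i * ln (1 / q)) ^ m"
    let ?f = "\<lambda>k. real k ^ Suc m / (real k * (1 - q ^ k)) * z ^ k"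
    have "?f sums quantum_polylog q (Suc m) z"
      unfolding quantum_polylog_def using z by (intro summable_sums summable_quantum_polylog q) auto
    moreover have "0 \<le> ?f k" for k
      using q z by (simp add: power_le_one)
    ultimately have "(?f has_sum quantum_polylog q (Suc m) z) UNIV"
      by (rule sums_nonneg_imp_has_sum)
    then have "((\<lambda>k. c * ?f k) has_sum c * quantum_polylog q (Suc m) z) UNIV"
      by (rule has_sum_cmult_right)
    also have "?this \<longleftrightarrow> ((\<lambda>n. ?h (n, i)) has_sum c * quantum_polylog q (Suc m) z) {1..}"
    proof (rule has_sum_cong_neutral)
      fix k :: nat assume "k \<in> UNIV \<inter> {1..}"
      then have k: "k \<noteq> 0"
        by auto
      have "z ^ k = q powr (real k * a i) * exp (- freq q A (k, i) * x)"
        using q by (simp add: z_def powr_def freq_def ln_div algebra_simps flip: exp_of_nat_mult exp_add)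
      moreover have "real k ^ Suc m / (real k * (1 - q ^ k)) = real k ^ m / (1 - q ^ k)"
        using k by simp
      ultimately show "c * ?f k = ?h (k, i)"
        by (simp add: c_def dirichlet_coeff_def freq_def power_mult_distrib)
    qed auto
    finally show ?thesis
      by (simp add: c_def z_def)
  qed
  have outer: "(?s has_sum psi_sum q p A a \<alpha> m x) {1..p}"
    unfolding psi_sum_def by (rule has_sum_finite) simp
  have nonneg: "0 \<le> ?h (n, i)" if "i \<in> {1..p}" "n \<in> {1..}" for n i
    using dirichlet_coeff_pos[OF q, of p A \<alpha> "(n, i)" a] freq_pos[OF q, of p A "(n, i)"] A that by simp
  have "((\<lambda>(i, n). ?h (n, i)) has_sum psi_sum q p A a \<alpha> m x) ({1..p} \<times> {1..})"
    using inner outer nonneg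
    by (intro has_sum_SigmaI summable_on_SigmaI) (auto intro: has_sum_imp_summable)
  then show ?thesis
    by (subst has_sum_swap) simp
qed

lemma DERIV_quantum_polylog_powr:
  assumes q: "0 < q" "q < 1" and "0 < A" "0 \<le> a" "0 < (x :: real)"
  shows "((\<lambda>x. quantum_polylog q m (q powr (A * x + a))) has_real_derivative
    - (A * ln (1 / q)) * quantum_polylog q (Suc m) (q powr (A * x + a))) (at x)"
proof -
  define z where "z = q powr (A * x + a)"
  have "0 < A * x + a"
    using assms by (simp add: add_pos_nonneg)
  then have z: "0 < z" "z < 1"
    using q powr_less_mono2[of "A * x + a" q 1] by (auto simp: z_def)
  have "((\<lambda>x. q powr (A * x + a)) has_real_derivative z * (A * ln q)) (at x)"
    unfolding z_def using q by (auto intro!: derivative_eq_intros)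
  then have "((\<lambda>x. quantum_polylog q m (q powr (A * x + a))) has_real_derivative
      quantum_polylog q (Suc m) z / z * (z * (A * ln q))) (at x)"
    using DERIV_quantum_polylog[OF q z, of m] unfolding z_def by (rule DERIV_chain2[rotated])
  then show ?thesis
    using z q by (simp add: z_def ln_div mult_ac)
qed

lemma DERIV_psi_sum:
  assumes q: "0 < q" "q < 1" and x: "0 < x"
    and A: "\<And>i. i \<in> {1..p} \<Longrightarrow> 0 < A i \<and> 0 < \<alpha> i \<and> 0 \<le> a i"
  shows "(psi_sum q p A a \<alpha> m has_real_derivative - psi_sum q p A a \<alpha> (Suc m) x) (at x)"
proof -
  have "((\<lambda>x. \<Sum>i=1..p. \<alpha> i * A i * (A i * ln (1 / q)) ^ m *
        quantum_polylog q (Suc m) (q powr (A i * x + a i))) has_real_derivative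
      (\<Sum>i=1..p. \<alpha> i * A i * (A i * ln (1 / q)) ^ m *
        (- (A i * ln (1 / q)) * quantum_polylog q (Suc (Suc m)) (q powr (A i * x + a i))))) (at x)"
    using A by (intro DERIV_sum DERIV_cmult DERIV_quantum_polylog_powr q x) auto
  then show ?thesis
    by (simp add: psi_sum_def[abs_def] sum_negf mult_ac)
qed

lemma psi_sum_tendsto_0:
  assumes q: "0 < q" "q < 1"
    and A: "\<And>i. i \<in> {1..p} \<Longrightarrow> 0 < A i \<and> 0 < \<alpha> i \<and> 0 \<le> a i"
  shows "(\<lambda>n. psi_sum q p A a \<alpha> m (real n)) \<longlonglongrightarrow> 0"
proof -
  have "(\<lambda>n. quantum_polylog q (Suc m) (q powr (A i * real n + a i))) \<longlonglongrightarrow> 0" if i: "i \<in> {1..p}" for i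
  proof (rule tendsto_quantum_polylog_0[OF q])
    have "q powr (A i * real n + a i) = (q powr A i) ^ n * q powr a i" for n
      using q by (simp add: powr_add powr_powr flip: powr_realpow)
    moreover have "(\<lambda>n. (q powr A i) ^ n) \<longlonglongrightarrow> 0"
      using q A[OF i] powr_less_mono2[of "A i" q 1] by (intro LIMSEQ_power_zero) auto
    ultimately show "(\<lambda>n. q powr (A i * real n + a i)) \<longlonglongrightarrow> 0"
      by (auto intro: tendsto_mult_left_zero)
  qed
  then show ?thesis
    unfolding psi_sum_def by (intro tendsto_null_sum tendsto_mult_right_zero) auto
qed

lemma W_q_pos_and_DERIV_ln:
  assumes q: "0 < q" "q < 1" and x: "0 < x"
    and A: "\<And>i. i \<in> {1..p} \<Longrightarrow> 0 < A i \<and> 0 < \<alpha> i \<and> 0 \<le> a i"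
    and B: "\<And>j. j \<in> {1..s} \<Longrightarrow> 0 < B j \<and> 0 < \<beta> j \<and> 0 \<le> b j"
  shows "0 < W_q q p A a \<alpha> s B b \<beta> x"
    and "((\<lambda>y. ln (W_q q p A a \<alpha> s B b \<beta> y)) has_real_derivative
      - (ln (1 - q) * ((\<Sum>i=1..p. \<alpha> i * A i) - (\<Sum>j=1..s. \<beta> j * B j))
         + ln (1 / q) * (psi_sum q p A a \<alpha> 0 x - psi_sum q s B b \<beta> 0 x))) (at x)"
proof -
  \<comment> \<open>\<open>G\<close> is the logarithm of one of the two products of powers of $q$-gamma values.\<close>
  define G where "G p A a \<alpha> y = (\<Sum>i=1..p. \<alpha> i *
      ((1 - (A i * y + a i)) * ln (1 - q) + quantum_polylog q 0 (q powr (A i * y + a i))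
        - quantum_polylog q 0 q))" for p :: nat and A a \<alpha> :: "nat \<Rightarrow> real" and y
  have prod_eq: "(\<Prod>i=1..p. q_Gamma q (A i * y + a i) powr \<alpha> i) = exp (G p A a \<alpha> y)"
    if "0 < y" and "\<And>i. i \<in> {1..p} \<Longrightarrow> 0 < A i \<and> 0 < \<alpha> i \<and> 0 \<le> a i" for p A a \<alpha> y
    unfolding G_def exp_sum[OF finite_atLeastAtMost]
    using that by (intro prod.cong) (auto simp: q_Gamma_eq_quantum_dilog[OF q] add_pos_nonneg powr_def)
  have W: "W_q q p A a \<alpha> s B b \<beta> y = exp (G p A a \<alpha> y - G s B b \<beta> y)" if "0 < y" for y
    using prod_eq[OF that, of p A \<alpha> a] prod_eq[OF that, of s B \<beta> b] A B by (simp add: W_q_def exp_diff)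
  show "0 < W_q q p A a \<alpha> s B b \<beta> x"
    using W[OF x] by simp
  have DERIV_G: "(G p A a \<alpha> has_real_derivative
      - (ln (1 - q) * (\<Sum>i=1..p. \<alpha> i * A i) + ln (1 / q) * psi_sum q p A a \<alpha> 0 x)) (at x)"
    if "\<And>i. i \<in> {1..p} \<Longrightarrow> 0 < A i \<and> 0 < \<alpha> i \<and> 0 \<le> a i" for p A a \<alpha>
  proof -
    have "(G p A a \<alpha> has_real_derivative (\<Sum>i=1..p. \<alpha> i *
        (- A i * ln (1 - q) + (- (A i * ln (1 / q)) * quantum_polylog q (Suc 0) (q powr (A i * x + a i)))
          - 0))) (at x)"
      unfolding G_def[abs_def] using that
      by (intro DERIV_sum DERIV_cmult DERIV_diff DERIV_add DERIV_const DERIV_quantum_polylog_powr q x)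
         (auto intro!: derivative_eq_intros)
    then show ?thesis
      by (simp add: psi_sum_def algebra_simps sum.distrib sum_distrib_left sum_negf sum_subtractf)
  qed
  have "((\<lambda>y. G p A a \<alpha> y - G s B b \<beta> y) has_real_derivative
      - (ln (1 - q) * ((\<Sum>i=1..p. \<alpha> i * A i) - (\<Sum>j=1..s. \<beta> j * B j))
         + ln (1 / q) * (psi_sum q p A a \<alpha> 0 x - psi_sum q s B b \<beta> 0 x))) (at x)"
    using DERIV_diff[OF DERIV_G[of p A \<alpha> a] DERIV_G[of s B \<beta> b]] A B by (simp add: algebra_simps)
  then show "((\<lambda>y. ln (W_q q p A a \<alpha> s B b \<beta> y)) has_real_derivative
      - (ln (1 - q) * ((\<Sum>i=1..p. \<alpha> i * A i) - (\<Sum>j=1..s. \<beta> j * B j))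
         + ln (1 / q) * (psi_sum q p A a \<alpha> 0 x - psi_sum q s B b \<beta> 0 x))) (at x)"
    by (rule has_field_derivative_transform_within_open[of _ _ _ "{0<..}"]) (use W x in auto)
qed

section \<open>Complete monotonicity\<close>

text \<open>A family $g_0,g_1,\dots$ of successive derivatives on $(0,\infty)$ replaces the iterated
  derivatives of $f$, even though $f$ may differ from $g_0$ off the half-line.\<close>
lemma completely_monotonic_iff_derivs:
  assumes eq: "\<And>x. 0 < x \<Longrightarrow> f x = g 0 x"
    and deriv: "\<And>m x. 0 < x \<Longrightarrow> (g m has_real_derivative g (Suc m) x) (at x)"
  shows "completely_monotonic f \<longleftrightarrow> (\<forall>m. \<forall>x>0. 0 \<le> (- 1) ^ m * g m x)"
proof -
  have transfer: "(h has_real_derivative g (Suc m) x) (at x)" if "\<And>y. 0 < y \<Longrightarrow> h y = g m y" "0 < x" for h m x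
    by (rule has_field_derivative_transform_within_open[OF deriv[OF that(2)], of "{0<..}"]) (use that in auto)
  have derivs: "(deriv ^^ m) f x = g m x" if "0 < x" for m x
    using that
  proof (induction m arbitrary: x)
    case (Suc m)
    then show ?case
      using transfer[of "(deriv ^^ m) f" m x] by (simp add: DERIV_imp_deriv)
  qed (simp add: eq)
  have "(deriv ^^ m) f differentiable (at x)" if "0 < x" for m x
    using transfer[of "(deriv ^^ m) f" m x] derivs that by (auto simp: real_differentiable_def)
  moreover have "(\<forall>m. \<forall>x>0. 0 \<le> (- 1) ^ m * g m x) \<longleftrightarrow>
      (\<forall>x>0. 0 \<le> g 0 x) \<and> (\<forall>m\<ge>1. \<forall>x>0. 0 \<le> (- 1) ^ m * g m x)"
    by (metis One_nat_def less_one linorder_not_le mult_1 power_0)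
  ultimately show ?thesis
    by (simp add: completely_monotonic_def derivs eq)
qed

text \<open>For derivatives of positive order complete monotonicity is literally the comparison of the two
  sums. At order $0$ it only says that the constant plus a multiple of the difference $D$ of the two
  sums is nonnegative; but $D\to0$ at infinity, which makes the constant nonnegative, and
  $D$ is nonincreasing by the comparison at order $1$, which makes $D$ nonnegative.\<close>
lemma log_completely_monotonic_W_q_iff:
  assumes q: "0 < q" "q < 1"
    and A: "\<And>i. i \<in> {1..p} \<Longrightarrow> 0 < A i \<and> 0 < \<alpha> i \<and> 0 \<le> a i"
    and B: "\<And>j. j \<in> {1..s} \<Longrightarrow> 0 < B j \<and> 0 < \<beta> j \<and> 0 \<le> b j"
  shows "log_completely_monotonic (W_q q p A a \<alpha> s B b \<beta>) \<longleftrightarrow>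
    (\<Sum>i=1..p. \<alpha> i * A i) \<le> (\<Sum>j=1..s. \<beta> j * B j) \<and>
    (\<forall>m. \<forall>x>0. psi_sum q s B b \<beta> m x \<le> psi_sum q p A a \<alpha> m x)"
proof -
  let ?W = "W_q q p A a \<alpha> s B b \<beta>"
  let ?SA = "psi_sum q p A a \<alpha>" and ?SB = "psi_sum q s B b \<beta>"
  define L where "L = ln (1 / q)"
  define C where "C = ln (1 - q) * ((\<Sum>i=1..p. \<alpha> i * A i) - (\<Sum>j=1..s. \<beta> j * B j))"
  have L: "0 < L"
    using q by (simp add: L_def)
  have C: "0 \<le> C \<longleftrightarrow> (\<Sum>i=1..p. \<alpha> i * A i) \<le> (\<Sum>j=1..s. \<beta> j * B j)"
    using q by (auto simp: C_def zero_le_mult_iff)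
  have W: "0 < ?W x" "((\<lambda>y. ln (?W y)) has_real_derivative - (C + L * (?SA 0 x - ?SB 0 x))) (at x)"
    if "0 < x" for x
    unfolding C_def L_def using W_q_pos_and_DERIV_ln[OF q that] A B by blast+
  have DA: "(?SA m has_real_derivative - ?SA (Suc m) x) (at x)"
    and DB: "(?SB m has_real_derivative - ?SB (Suc m) x) (at x)" if "0 < x" for m x
    using DERIV_psi_sum[OF q that] A B by blast+
  define g where "g m x = (if m = 0 then C else 0) + (- 1) ^ m * (L * (?SA m x - ?SB m x))"
    for m :: nat and x
  have "log_completely_monotonic ?W \<longleftrightarrow> completely_monotonic (\<lambda>x. - deriv (\<lambda>y. ln (?W y)) x)"
    unfolding log_completely_monotonic_def real_differentiable_def using W by blast
  also have "\<dots> \<longleftrightarrow> (\<forall>m. \<forall>x>0. 0 \<le> (- 1) ^ m * g m x)"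
  proof (rule completely_monotonic_iff_derivs)
    show "- deriv (\<lambda>y. ln (?W y)) x = g 0 x" if "0 < x" for x
      using DERIV_imp_deriv[OF W(2)[OF that]] by (simp add: g_def)
    show "(g m has_real_derivative g (Suc m) x) (at x)" if "0 < x" for m x
      unfolding g_def[abs_def]
      by (rule derivative_eq_intros refl DA[OF that] DB[OF that] | simp add: algebra_simps)+
  qed
  also have "\<dots> \<longleftrightarrow> 0 \<le> C \<and> (\<forall>m. \<forall>x>0. ?SB m x \<le> ?SA m x)"
  proof -
    have signed: "(- 1) ^ m * g m x = (if m = 0 then C else 0) + L * (?SA m x - ?SB m x)" for m x
      by (simp add: g_def flip: mult.assoc power_mult_distrib)
    have lim: "(\<lambda>n. ?SA 0 (real n) - ?SB 0 (real n)) \<longlonglongrightarrow> 0"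
      using tendsto_diff[OF psi_sum_tendsto_0[OF q, of p A \<alpha> a 0] psi_sum_tendsto_0[OF q, of s B \<beta> b 0]]
        A B by simp
    have "0 \<le> C \<and> (\<forall>m. \<forall>x>0. ?SB m x \<le> ?SA m x)"
      if nonneg: "\<forall>m. \<forall>x>0. 0 \<le> (- 1) ^ m * g m x"
    proof (intro conjI allI impI)
      have "(\<lambda>n. C + L * (?SA 0 (real n) - ?SB 0 (real n))) \<longlonglongrightarrow> C + L * 0"
        by (intro tendsto_intros lim)
      moreover have "\<forall>n\<ge>1. 0 \<le> C + L * (?SA 0 (real n) - ?SB 0 (real n))"
        using nonneg[rule_format, of _ 0] by (simp only: signed) simp
      ultimately show "0 \<le> C"
        using LIMSEQ_le_const[of _ "C + L * 0" 0] by auto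
      have pos: "?SB m x \<le> ?SA m x" if "0 < m" "0 < x" for m x
        using nonneg[rule_format, OF that(2), of m] that(1) L by (simp add: signed zero_le_mult_iff)
      show "?SB m x \<le> ?SA m x" if "0 < x" for m x
      proof (cases "m = 0")
        case True
        have "?SA 0 (real n) - ?SB 0 (real n) \<le> ?SA 0 x - ?SB 0 x" if "x \<le> real n" for n
        proof (rule DERIV_nonpos_imp_nonincreasing[OF that])
          fix y assume "x \<le> y"
          then have y: "0 < y"
            using \<open>0 < x\<close> by simp
          show "\<exists>d. ((\<lambda>y. ?SA 0 y - ?SB 0 y) has_real_derivative d) (at y) \<and> d \<le> 0"
            using DERIV_diff[OF DA[OF y, of 0] DB[OF y, of 0]] pos[of 1 y] y by fastforce
        qed
        then have "\<forall>n\<ge>nat \<lceil>x\<rceil>. ?SA 0 (real n) - ?SB 0 (real n) \<le> ?SA 0 x - ?SB 0 x"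
          by (simp add: nat_le_iff ceiling_le_iff)
        then have "0 \<le> ?SA 0 x - ?SB 0 x"
          using LIMSEQ_le_const2[OF lim] by blast
        then show ?thesis
          using True by simp
      qed (use pos that in auto)
    qed
    moreover have "\<forall>m. \<forall>x>0. 0 \<le> (- 1) ^ m * g m x"
      if "0 \<le> C \<and> (\<forall>m. \<forall>x>0. ?SB m x \<le> ?SA m x)"
      using that L by (simp add: signed)
    ultimately show ?thesis
      by blast
  qed
  finally show ?thesis
    by (simp add: C)
qed

text \<open>Scaled derivatives at $x=n/t$ converge to the coefficient of $e^{-tx}$.\<close>
lemma tendsto_psi_sum_peak:
  assumes q: "0 < q" "q < 1" and t: "0 < t"
    and A: "\<And>i. i \<in> {1..p} \<Longrightarrow> 0 < A i \<and> 0 < \<alpha> i \<and> 0 \<le> a i"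
  shows "(\<lambda>n. (exp 1 / t) ^ n * psi_sum q p A a \<alpha> n (real n / t)) \<longlonglongrightarrow>
    (\<Sum>z\<in>{z \<in> {1..} \<times> {1..p}. freq q A z = t}. dirichlet_coeff q A a \<alpha> z)"
proof (rule Lim_transform_eventually)
  let ?P = "{1..} \<times> {1..p}" and ?w = "dirichlet_coeff q A a \<alpha>" and ?\<nu> = "freq q A"
  have sums: "((\<lambda>z. ?w z * ?\<nu> z ^ m * exp (- ?\<nu> z * x)) has_sum psi_sum q p A a \<alpha> m x) ?P"
    if "0 < x" for m x
    by (rule has_sum_psi_sum[OF q that]) (use A in auto)
  have "(\<lambda>n. (exp 1 / t) ^ n * (\<Sum>\<^sub>\<infinity>z\<in>?P. ?w z * ?\<nu> z ^ n * exp (- ?\<nu> z * (real n / t))))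
      \<longlonglongrightarrow> (\<Sum>\<^sub>\<infinity>z\<in>{z \<in> ?P. ?\<nu> z = t}. ?w z)"
  proof (rule tendsto_infsum_exp_peak[OF _ _ t])
    show "0 < ?\<nu> z" "0 \<le> ?w z" if "z \<in> ?P" for z
      using freq_pos[OF q _ that] dirichlet_coeff_pos[OF q _ that] A by (auto simp: less_imp_le)
    show "(\<lambda>z. ?w z * ?\<nu> z ^ 1 * exp (- ?\<nu> z * (real 1 / t))) summable_on ?P"
      using t by (intro has_sum_imp_summable[OF sums]) simp
  qed
  moreover have "finite {z \<in> ?P. ?\<nu> z = t}"
    using finite_freq_fibre[OF q] A by blast
  ultimately show "(\<lambda>n. (exp 1 / t) ^ n *
      (\<Sum>\<^sub>\<infinity>z\<in>?P. ?w z * ?\<nu> z ^ n * exp (- ?\<nu> z * (real n / t)))) \<longlonglongrightarrow>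
      (\<Sum>z\<in>{z \<in> ?P. ?\<nu> z = t}. ?w z)"
    by (simp only: infsum_finite)
  show "\<forall>\<^sub>F n in sequentially. (exp 1 / t) ^ n *
      (\<Sum>\<^sub>\<infinity>z\<in>?P. ?w z * ?\<nu> z ^ n * exp (- ?\<nu> z * (real n / t))) =
      (exp 1 / t) ^ n * psi_sum q p A a \<alpha> n (real n / t)"
    using eventually_gt_at_top[of 0]
  proof eventually_elim
    case (elim n)
    then show ?case
      using infsumI[OF sums[of "real n / t" n]] t by simp
  qed
qed

text \<open>From left to right, the peaks at $x=n/t$ recover the coefficients; from right to left, all terms of
  a fibre carry the same factor $t^me^{-tx}>0$, so the comparison of coefficients passes to the
  series.\<close>
lemma psi_sum_le_iff_fibre_sums_le:
  assumes q: "0 < q" "q < 1"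
    and A: "\<And>i. i \<in> {1..p} \<Longrightarrow> 0 < A i \<and> 0 < \<alpha> i \<and> 0 \<le> a i"
    and B: "\<And>j. j \<in> {1..s} \<Longrightarrow> 0 < B j \<and> 0 < \<beta> j \<and> 0 \<le> b j"
  shows "(\<forall>m. \<forall>x>0. psi_sum q s B b \<beta> m x \<le> psi_sum q p A a \<alpha> m x) \<longleftrightarrow>
    (\<forall>t\<in>hat_set q s B.
      (\<Sum>z\<in>{z \<in> {1..} \<times> {1..s}. freq q B z = t}. dirichlet_coeff q B b \<beta> z)
        \<le> (\<Sum>z\<in>{z \<in> {1..} \<times> {1..p}. freq q A z = t}. dirichlet_coeff q A a \<alpha> z))"
    (is "?dominated \<longleftrightarrow> (\<forall>t\<in>_. ?fibreB t \<le> ?fibreA t)")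
proof -
  have sumA: "((\<lambda>z. dirichlet_coeff q A a \<alpha> z * freq q A z ^ m * exp (- freq q A z * x)) has_sum
      psi_sum q p A a \<alpha> m x) ({1..} \<times> {1..p})" if "0 < x" for m x
    by (rule has_sum_psi_sum[OF q that]) (use A in auto)
  have sumB: "((\<lambda>z. dirichlet_coeff q B b \<beta> z * freq q B z ^ m * exp (- freq q B z * x)) has_sum
      psi_sum q s B b \<beta> m x) ({1..} \<times> {1..s})" if "0 < x" for m x
    by (rule has_sum_psi_sum[OF q that]) (use B in auto)
  have posA: "0 < freq q A z" "0 \<le> dirichlet_coeff q A a \<alpha> z" if "z \<in> {1..} \<times> {1..p}" for z
    using freq_pos[OF q _ that] dirichlet_coeff_pos[OF q _ that] A by (auto simp: less_imp_le)
  have posB: "0 < freq q B z" "0 \<le> dirichlet_coeff q B b \<beta> z" if "z \<in> {1..} \<times> {1..s}" for z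
    using freq_pos[OF q _ that] dirichlet_coeff_pos[OF q _ that] B by (auto simp: less_imp_le)
  have finA: "finite {z \<in> {1..} \<times> {1..p}. freq q A z = t}" for t
    using finite_freq_fibre[OF q] A by blast
  have finB: "finite {z \<in> {1..} \<times> {1..s}. freq q B z = t}" for t
    using finite_freq_fibre[OF q] B by blast
  show ?thesis
  proof (intro iffI ballI allI impI)
    fix t assume le: ?dominated and "t \<in> hat_set q s B"
    then have t: "0 < t"
      using posB(1) by (auto simp: hat_set_eq_freq_image)
    have limA: "(\<lambda>n. (exp 1 / t) ^ n * psi_sum q p A a \<alpha> n (real n / t)) \<longlonglongrightarrow> ?fibreA t"
      by (rule tendsto_psi_sum_peak[OF q t]) (use A in auto)
    have limB: "(\<lambda>n. (exp 1 / t) ^ n * psi_sum q s B b \<beta> n (real n / t)) \<longlonglongrightarrow> ?fibreB t"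
      by (rule tendsto_psi_sum_peak[OF q t]) (use B in auto)
    show "?fibreB t \<le> ?fibreA t"
    proof (rule LIMSEQ_le[OF limB limA])
      show "\<exists>N. \<forall>n\<ge>N. (exp 1 / t) ^ n * psi_sum q s B b \<beta> n (real n / t)
          \<le> (exp 1 / t) ^ n * psi_sum q p A a \<alpha> n (real n / t)"
        using le t by (intro exI[of _ 1] allI impI mult_left_mono) auto
    qed
  next
    fix m :: nat and x :: real
    assume le: "\<forall>t\<in>hat_set q s B. ?fibreB t \<le> ?fibreA t" and x: "0 < x"
    have "(\<Sum>z\<in>{z \<in> {1..} \<times> {1..s}. freq q B z = t}.
          dirichlet_coeff q B b \<beta> z * freq q B z ^ m * exp (- freq q B z * x))
        \<le> (\<Sum>z\<in>{z \<in> {1..} \<times> {1..p}. freq q A z = t}.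
          dirichlet_coeff q A a \<alpha> z * freq q A z ^ m * exp (- freq q A z * x))"
      if "t \<in> freq q B ` ({1..} \<times> {1..s})" for t
    proof -
      have "0 < t"
        using posB(1) that by auto
      then have "?fibreB t * (t ^ m * exp (- t * x)) \<le> ?fibreA t * (t ^ m * exp (- t * x))"
        using le that by (intro mult_right_mono) (auto simp: hat_set_eq_freq_image)
      then show ?thesis
        by (simp add: sum_distrib_right mult.assoc)
    qed
    then show "psi_sum q s B b \<beta> m x \<le> psi_sum q p A a \<alpha> m x"
      unfolding infsumI[OF sumA[OF x], symmetric] infsumI[OF sumB[OF x], symmetric]
      using sumA[OF x, THEN has_sum_imp_summable] sumB[OF x, THEN has_sum_imp_summable] finA finB posA posB
      by (intro infsum_le_infsum_fibrewise[of _ _ _ _ "freq q A" "freq q B"]) (auto simp: less_imp_le)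
  qed
qed

text \<open>On the fibre over $t$ the factor $nA_i$ by which the two summands differ has the constant value
  $t/\log(1/q)$.\<close>
lemma weighted_fibre_sum:
  assumes "0 < q" "q < 1"
  shows "(\<Sum>(n, i) | 1 \<le> n \<and> i \<in> {1..p} \<and> real n * A i * ln (1 / q) = t.
      real n / (1 - q ^ n) * \<alpha> i * (A i)\<^sup>2 * q powr (real n * a i)) =
    t / ln (1 / q) * (\<Sum>z\<in>{z \<in> {1..} \<times> {1..p}. freq q A z = t}. dirichlet_coeff q A a \<alpha> z)"
  unfolding sum_distrib_left
proof (rule sum.cong)
  show "{(n, i). 1 \<le> n \<and> i \<in> {1..p} \<and> real n * A i * ln (1 / q) = t} =
      {z \<in> {1..} \<times> {1..p}. freq q A z = t}"
    by (auto simp: freq_def)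
  fix z assume "z \<in> {z \<in> {1..} \<times> {1..p}. freq q A z = t}"
  then have "t / ln (1 / q) = real (fst z) * A (snd z)"
    using assms by (auto simp: freq_def)
  then show "(case z of (n, i) \<Rightarrow> real n / (1 - q ^ n) * \<alpha> i * (A i)\<^sup>2 * q powr (real n * a i)) =
      t / ln (1 / q) * dirichlet_coeff q A a \<alpha> z"
    by (simp add: dirichlet_coeff_def case_prod_unfold power2_eq_square)
qed

text \<open>The inclusion at $t=B_j\log(1/q)$ yields $n_j$ and $i_j$; conversely, a multiple of a multiple is a multiple.\<close>
lemma multiples_iff_hat_set_subset:
  assumes "0 < q" "q < 1"
  shows "(\<exists>(n :: nat \<Rightarrow> nat) (k :: nat \<Rightarrow> nat). \<forall>j\<in>{1..s}.
        1 \<le> n j \<and> k j \<in> {1..p} \<and> B j = real (n j) * A (k j)) \<longleftrightarrow>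
    hat_set q s B \<subseteq> hat_set q p A"
proof
  assume "\<exists>(n :: nat \<Rightarrow> nat) (k :: nat \<Rightarrow> nat). \<forall>j\<in>{1..s}.
    1 \<le> n j \<and> k j \<in> {1..p} \<and> B j = real (n j) * A (k j)"
  then obtain n k :: "nat \<Rightarrow> nat" where nk:
    "\<And>j. j \<in> {1..s} \<Longrightarrow> 1 \<le> n j \<and> k j \<in> {1..p} \<and> B j = real (n j) * A (k j)"
    by blast
  show "hat_set q s B \<subseteq> hat_set q p A"
  proof
    fix t assume "t \<in> hat_set q s B"
    then obtain m j where mj: "1 \<le> m" "j \<in> {1..s}" "t = real m * B j * ln (1 / q)"
      by (auto simp: hat_set_def)
    then have "t = real (m * n j) * A (k j) * ln (1 / q)" "1 \<le> m * n j" "k j \<in> {1..p}"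
      using nk[of j] by auto
    then show "t \<in> hat_set q p A"
      unfolding hat_set_def by blast
  qed
next
  assume sub: "hat_set q s B \<subseteq> hat_set q p A"
  have "\<exists>n k. 1 \<le> n \<and> k \<in> {1..p} \<and> B j = real n * A k" if "j \<in> {1..s}" for j
  proof -
    have "real 1 * B j * ln (1 / q) \<in> hat_set q p A"
      using sub that unfolding hat_set_def by blast
    then show ?thesis
      using assms by (force simp: hat_set_def)
  qed
  then show "\<exists>(n :: nat \<Rightarrow> nat) (k :: nat \<Rightarrow> nat). \<forall>j\<in>{1..s}.
    1 \<le> n j \<and> k j \<in> {1..p} \<and> B j = real (n j) * A (k j)"
    by metis
qed

theorem theorem2p3:
  fixes q :: real and p s :: nat
    and A a \<alpha> B b \<beta> :: "nat \<Rightarrow> real"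
  assumes "0 < q" and "q < 1"
    and "\<And>i. i \<in> {1..p} \<Longrightarrow> 0 < A i \<and> 0 < \<alpha> i \<and> 0 \<le> a i"
    and "\<And>j. j \<in> {1..s} \<Longrightarrow> 0 < B j \<and> 0 < \<beta> j \<and> 0 \<le> b j"
  shows
    "(log_completely_monotonic (W_q q p A a \<alpha> s B b \<beta>) \<longleftrightarrow>
        (\<exists>(n :: nat \<Rightarrow> nat) (k :: nat \<Rightarrow> nat). \<forall>j\<in>{1..s}.
            1 \<le> n j \<and> k j \<in> {1..p} \<and> B j = real (n j) * A (k j)) \<and>
        (\<forall>t\<in>hat_set q s B.
            (\<Sum>(n, i) | 1 \<le> n \<and> i \<in> {1..p} \<and> real n * A i * ln (1 / q) = t.
               real n / (1 - q ^ n) * \<alpha> i * (A i)\<^sup>2 * q powr (real n * a i))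
          \<ge> (\<Sum>(m, j) | 1 \<le> m \<and> j \<in> {1..s} \<and> real m * B j * ln (1 / q) = t.
               real m / (1 - q ^ m) * \<beta> j * (B j)\<^sup>2 * q powr (real m * b j))) \<and>
        (\<Sum>i=1..p. \<alpha> i * A i) \<le> (\<Sum>j=1..s. \<beta> j * B j))
     \<and> ((\<exists>(n :: nat \<Rightarrow> nat) (k :: nat \<Rightarrow> nat). \<forall>j\<in>{1..s}.
            1 \<le> n j \<and> k j \<in> {1..p} \<and> B j = real (n j) * A (k j)) \<longleftrightarrow>
        hat_set q s B \<subseteq> hat_set q p A)"
proof (rule conjI[OF _ multiples_iff_hat_set_subset[OF assms(1,2)]])
  note q = assms(1,2) and A = assms(3) and B = assms(4)
  let ?mult = "\<exists>(n :: nat \<Rightarrow> nat) (k :: nat \<Rightarrow> nat). \<forall>j\<in>{1..s}.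
    1 \<le> n j \<and> k j \<in> {1..p} \<and> B j = real (n j) * A (k j)"
  let ?fibreA = "\<lambda>t. \<Sum>z\<in>{z \<in> {1..} \<times> {1..p}. freq q A z = t}. dirichlet_coeff q A a \<alpha> z"
  let ?fibreB = "\<lambda>t. \<Sum>z\<in>{z \<in> {1..} \<times> {1..s}. freq q B z = t}. dirichlet_coeff q B b \<beta> z"
  have scale: "0 < t / ln (1 / q)" if "t \<in> hat_set q s B" for t
    using that freq_pos[OF q, of s B] B q by (auto simp: hat_set_eq_freq_image intro!: divide_pos_pos)
  \<comment> \<open>A nonempty fibre over $t$ in the second family has a positive sum, so the first family
    cannot have an empty fibre there.\<close>
  have mult: ?mult if le: "\<forall>t\<in>hat_set q s B. ?fibreB t \<le> ?fibreA t"
    unfolding multiples_iff_hat_set_subset[OF q]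
  proof
    fix t assume t: "t \<in> hat_set q s B"
    have "0 < ?fibreB t"
    proof (rule sum_pos)
      show "finite {z \<in> {1..} \<times> {1..s}. freq q B z = t}"
        using finite_freq_fibre[OF q] B by blast
      show "{z \<in> {1..} \<times> {1..s}. freq q B z = t} \<noteq> {}"
        using t unfolding hat_set_eq_freq_image by blast
      show "0 < dirichlet_coeff q B b \<beta> z" if "z \<in> {z \<in> {1..} \<times> {1..s}. freq q B z = t}" for z
        using dirichlet_coeff_pos[OF q, of s B \<beta> z b] B that by auto
    qed
    also have "\<dots> \<le> ?fibreA t"
      using le t by blast
    finally have "{z \<in> {1..} \<times> {1..p}. freq q A z = t} \<noteq> {}"
      by (metis less_irrefl sum.empty)
    then show "t \<in> hat_set q p A"
      by (auto simp: hat_set_eq_freq_image)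
  qed
  have lcm: "log_completely_monotonic (W_q q p A a \<alpha> s B b \<beta>) \<longleftrightarrow>
      (\<Sum>i=1..p. \<alpha> i * A i) \<le> (\<Sum>j=1..s. \<beta> j * B j) \<and>
      (\<forall>m. \<forall>x>0. psi_sum q s B b \<beta> m x \<le> psi_sum q p A a \<alpha> m x)"
    by (rule log_completely_monotonic_W_q_iff[OF q]) (use A B in auto)
  have dom: "(\<forall>m. \<forall>x>0. psi_sum q s B b \<beta> m x \<le> psi_sum q p A a \<alpha> m x) \<longleftrightarrow>
      (\<forall>t\<in>hat_set q s B. ?fibreB t \<le> ?fibreA t)"
    by (rule psi_sum_le_iff_fibre_sums_le[OF q]) (use A B in auto)
  have weighted: "t / ln (1 / q) * ?fibreB t \<le> t / ln (1 / q) * ?fibreA t \<longleftrightarrow> ?fibreB t \<le> ?fibreA t"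
    if "t \<in> hat_set q s B" for t
    using scale[OF that] by (rule mult_le_cancel_left_pos)
  show "log_completely_monotonic (W_q q p A a \<alpha> s B b \<beta>) \<longleftrightarrow>
      ?mult \<and>
        (\<forall>t\<in>hat_set q s B.
            (\<Sum>(n, i) | 1 \<le> n \<and> i \<in> {1..p} \<and> real n * A i * ln (1 / q) = t.
               real n / (1 - q ^ n) * \<alpha> i * (A i)\<^sup>2 * q powr (real n * a i))
          \<ge> (\<Sum>(m, j) | 1 \<le> m \<and> j \<in> {1..s} \<and> real m * B j * ln (1 / q) = t.
               real m / (1 - q ^ m) * \<beta> j * (B j)\<^sup>2 * q powr (real m * b j))) \<and>
        (\<Sum>i=1..p. \<alpha> i * A i) \<le> (\<Sum>j=1..s. \<beta> j * B j)"
    unfolding lcm dom weighted_fibre_sum[OF q] using mult weighted by blast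
qed

end
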